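(* Let $n\ge 2$ and $d\ge 1$ be integers, let $\mathbf{W}\in\mathbb{R}^{n\times d}$, $\mathbf{b}\in\mathbb{R}^n$, and let $t\in\{1,\dots,n\}$. Consider the following linear programme in the variables $\mathbf{x}\in\mathbb{R}^d$ and $r\in\mathbb{R}$: maximise $r$ subject to $$(\mathbf{w}_{c_i}-\mathbf{w}_{c_t})^\top\mathbf{x}+r\,\|\mathbf{w}_{c_i}-\mathbf{w}_{c_t}\|_2\le -(b_{c_i}-b_{c_t})\quad\text{for all } i\in\{1,\dots,n\},\ i\ne t,$$ $$-100\le x_k\le 100\quad\text{for all } k\in\{1,\dots,d\},\qquad r>0.$$ (1) If this programme is feasible, then class $c_t$ is argmaxable, and for every feasible point $(\mathbf{x},r)$ the $d$-dimensional volume (possibly infinite) of the region $\{\mathbf{z}\in\mathbb{R}^d : P(c_i\mid\mathbf{z})<P(c_t\mid\mathbf{z})\ \text{for all } i\neq t\}$ is at least the volume of a Euclidean ball of radius $r$ in $\mathbb{R}^d$. (2) If this programme is infeasible, then class $c_t$ is unargmaxable. Here argmaxable and unargmaxable are understood with respect to inputs in the box $[-100,100]^d$.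
   Context: There are $n=|C|$ classes $c_1,\dots,c_n$. The vector $\mathbf{w}_{c_i}\in\mathbb{R}^d$ is the $i$-th row of $\mathbf{W}$ (viewed as a column vector) and $b_{c_i}$ is the $i$-th entry of $\mathbf{b}$. The Softmax classifier parametrised by $\mathbf{W}$ and $\mathbf{b}$ assigns to an input $\mathbf{x}\in\mathbb{R}^d$ the class probabilities $$P(c_j\mid\mathbf{x})=\frac{e^{\mathbf{w}_{c_j}^\top\mathbf{x}+b_{c_j}}}{\sum_{i=1}^n e^{\mathbf{w}_{c_i}^\top\mathbf{x}+b_{c_i}}},\qquad 1\le j\le n.$$ Inputs of the Softmax layer are assumed to be bounded, $-100\le x_k\le 100$ in every coordinate $k$. Class $c_t$ is called argmaxable if there exists an input $\mathbf{x}\in[-100,100]^d$ with $P(c_i\mid\mathbf{x})<P(c_t\mid\mathbf{x})$ for all $i\ne t$; it is called unargmaxable if no such input exists. A linear programme is feasible if some $(\mathbf{x},r)$ satisfies all of its constraints (including the strict constraint $r>0$), and infeasible otherwise.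
   Formalization: Part (1) additionally assumes that no class other than c_t has the same weight vector and the same bias as c_t; otherwise it fails: with W = 0 and b = 0 the programme is feasible, yet all classes tie, so c_t is not argmaxable and its region is empty. *)

theory Defs
  imports "HOL-Analysis.Analysis"
begin

text \<open>
  Classes are the elements of the finite index type \<open>'n\<close> and input coordinates those of \<open>'d\<close>;
  \<open>W $ i\<close> is the row of \<open>W\<close> belonging to class \<open>i\<close>.
\<close>

definition softmax_prob :: "real^'d^'n \<Rightarrow> real^'n \<Rightarrow> real^'d \<Rightarrow> 'n \<Rightarrow> real" where
  "softmax_prob W b x j = exp (W $ j \<bullet> x + b $ j) / (\<Sum>i\<in>UNIV. exp (W $ i \<bullet> x + b $ i))"

definition input_box :: "(real^'d) set" where
  "input_box = {x. \<forall>k. -100 \<le> x $ k \<and> x $ k \<le> 100}"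

definition argmax_region :: "real^'d^'n \<Rightarrow> real^'n \<Rightarrow> 'n \<Rightarrow> (real^'d) set" where
  "argmax_region W b t = {z. \<forall>i. i \<noteq> t \<longrightarrow> softmax_prob W b z i < softmax_prob W b z t}"

definition argmaxable :: "real^'d^'n \<Rightarrow> real^'n \<Rightarrow> 'n \<Rightarrow> bool" where
  "argmaxable W b t \<longleftrightarrow>
     (\<exists>x\<in>input_box. \<forall>i. i \<noteq> t \<longrightarrow> softmax_prob W b x i < softmax_prob W b x t)"

definition unargmaxable :: "real^'d^'n \<Rightarrow> real^'n \<Rightarrow> 'n \<Rightarrow> bool" where
  "unargmaxable W b t \<longleftrightarrow> \<not> argmaxable W b t"

definition lp_feasible_point :: "real^'d^'n \<Rightarrow> real^'n \<Rightarrow> 'n \<Rightarrow> real^'d \<Rightarrow> real \<Rightarrow> bool" where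
  "lp_feasible_point W b t x r \<longleftrightarrow>
     (\<forall>i. i \<noteq> t \<longrightarrow> (W $ i - W $ t) \<bullet> x + r * norm (W $ i - W $ t) \<le> - (b $ i - b $ t)) \<and>
     (\<forall>k. -100 \<le> x $ k \<and> x $ k \<le> 100) \<and>
     r > 0"

definition lp_feasible :: "real^'d^'n \<Rightarrow> real^'n \<Rightarrow> 'n \<Rightarrow> bool" where
  "lp_feasible W b t \<longleftrightarrow> (\<exists>x r. lp_feasible_point W b t x r)"

text \<open>
  If another class has the same weights and the same bias as class \<open>t\<close>, its constraint reads
  \<open>0 \<le> 0\<close> although the two classes are tied for every input. The programme can then be feasible
  for a class that is not argmaxable, as the following degenerate instance shows. Feasibility
  therefore implies argmaxability only if no other class has the same weights and bias as \<open>t\<close>.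
\<close>

lemma duplicate_class_counterexample:
  fixes t :: "'n::finite"
  assumes "CARD('n) \<ge> 2"
  shows "lp_feasible_point (0 :: real^'d^'n) 0 t 0 r \<longleftrightarrow> r > 0"
    and "unargmaxable (0 :: real^'d^'n) 0 t"
    and "argmax_region (0 :: real^'d^'n) 0 t = {}"
proof -
  obtain i :: 'n where "i \<noteq> t"
  proof (rule ccontr)
    assume "\<not> thesis"
    with that have "(UNIV :: 'n set) = {t}" by blast
    then have "CARD('n) = card {t}" by (rule arg_cong)
    with assms show False by simp
  qed
  then show "unargmaxable (0 :: real^'d^'n) 0 t"
    and "argmax_region (0 :: real^'d^'n) 0 t = {}"
    by (auto simp: unargmaxable_def argmaxable_def argmax_region_def softmax_prob_def)
  show "lp_feasible_point (0 :: real^'d^'n) 0 t 0 r \<longleftrightarrow> r > 0"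
    by (simp add: lp_feasible_point_def)
qed

end

theory Submission
  imports Defs
begin

text \<open>
  Softmax is monotone in the logits, so class \<open>t\<close> beats class \<open>i\<close> exactly on an open half-space.
  The constraint of the programme for \<open>i\<close> says that the open ball of radius \<open>r\<close> around \<open>x\<close>
  lies in that half-space. Conversely, a point of finitely many open half-spaces has positive
  distance to their boundaries.
\<close>

lemma softmax_prob_less_iff:
  \<comment> \<open>The two probabilities share a positive denominator, so only the logits are
    compared.\<close>
  "softmax_prob W b x i < softmax_prob W b x j \<longleftrightarrow> (W $ i - W $ j) \<bullet> x < b $ j - b $ i"
proof -
  have "(\<Sum>k\<in>UNIV. exp (W $ k \<bullet> x + b $ k)) > 0"
    by (simp add: sum_pos)
  then show ?thesis
    by (auto simp: softmax_prob_def divide_less_cancel inner_diff_left)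
qed

lemma argmax_region_eq:
  "argmax_region W b t = (\<Inter>i\<in>-{t}. {z. (W $ i - W $ t) \<bullet> z < b $ t - b $ i})"
  by (auto simp: argmax_region_def softmax_prob_less_iff)

lemma argmaxable_iff: "argmaxable W b t \<longleftrightarrow> input_box \<inter> argmax_region W b t \<noteq> {}"
  by (auto simp: argmaxable_def argmax_region_def)

text \<open>Supplies the Borel measurability needed to compare volumes.\<close>

lemma open_argmax_region: "open (argmax_region W b t)"
  unfolding argmax_region_eq by (intro open_INT ballI open_halfspace_lt) simp

text \<open>By Cauchy-Schwarz, moving by less than \<open>r\<close> raises
  \<open>v \<bullet> x\<close> by less than \<open>r * norm v\<close> if
  \<open>v \<noteq> 0\<close>. For \<open>v = 0\<close> the first assumption gives only
  \<open>0 \<le> c\<close>, and the second makes it strict.\<close>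

lemma ball_subset_halfspace_lt:
  assumes "v \<bullet> x + r * norm v \<le> c" and "v = 0 \<Longrightarrow> c \<noteq> 0"
  shows "ball x r \<subseteq> {z. v \<bullet> z < c}"
proof
  fix z assume "z \<in> ball x r"
  then have z: "norm (z - x) < r"
    by (simp add: dist_norm norm_minus_commute)
  show "z \<in> {z. v \<bullet> z < c}"
  proof (cases "v = 0")
    case True
    with assms show ?thesis by simp
  next
    case False
    have "v \<bullet> z = v \<bullet> x + v \<bullet> (z - x)"
      by (simp add: inner_diff_right)
    also have "\<dots> \<le> v \<bullet> x + norm v * norm (z - x)"
      by (simp add: norm_cauchy_schwarz)
    also have "\<dots> < v \<bullet> x + r * norm v"
      using z False by (simp add: mult.commute)
    finally show ?thesis
      using assms(1) by simp
  qed
qed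

lemma lp_feasible_point_ball_subset:
  assumes "lp_feasible_point W b t x r"
    and "\<forall>i. i \<noteq> t \<longrightarrow> (W $ i, b $ i) \<noteq> (W $ t, b $ t)"
  shows "ball x r \<subseteq> argmax_region W b t"
  unfolding argmax_region_eq
proof (rule INT_greatest)
  fix i assume "i \<in> -{t}"
  \<comment> \<open>If the weight rows coincide, the biases differ, so the right-hand side is
    nonzero.\<close>
  with assms show "ball x r \<subseteq> {z. (W $ i - W $ t) \<bullet> z < b $ t - b $ i}"
    by (intro ball_subset_halfspace_lt) (auto simp: lp_feasible_point_def)
qed

lemma emeasure_argmax_region_ge:
  fixes W :: "real^'d^'n"
  assumes "lp_feasible_point W b t x r"
    and "\<forall>i. i \<noteq> t \<longrightarrow> (W $ i, b $ i) \<noteq> (W $ t, b $ t)"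
  shows "emeasure lborel (ball (0 :: real^'d) r) \<le> emeasure lborel (argmax_region W b t)"
proof -
  have "r \<ge> 0"
    using assms(1) by (simp add: lp_feasible_point_def)
  \<comment> \<open>The volume of a ball depends on its radius, not on its centre.\<close>
  then have "emeasure lborel (ball (0 :: real^'d) r) = emeasure lborel (ball x r)"
    by (simp add: emeasure_ball)
  also have "\<dots> \<le> emeasure lborel (argmax_region W b t)"
    using lp_feasible_point_ball_subset[OF assms]
    by (rule emeasure_mono) (simp add: open_argmax_region)
  finally show ?thesis .
qed

text \<open>The witness is the centre \<open>x\<close>: it obeys the box constraints, whereas the
  ball around it may leave the box.\<close>

lemma lp_feasible_imp_argmaxable:
  assumes "lp_feasible W b t"
    and "\<forall>i. i \<noteq> t \<longrightarrow> (W $ i, b $ i) \<noteq> (W $ t, b $ t)"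
  shows "argmaxable W b t"
proof -
  obtain x r where xr: "lp_feasible_point W b t x r"
    using assms(1) by (auto simp: lp_feasible_def)
  then have "x \<in> input_box" "x \<in> ball x r"
    by (auto simp: lp_feasible_point_def input_box_def)
  with lp_feasible_point_ball_subset[OF xr assms(2)] show ?thesis
    unfolding argmaxable_iff by blast
qed

lemma argmaxable_imp_lp_feasible:
  assumes "argmaxable W b t"
  shows "lp_feasible W b t"
proof -
  obtain x where box: "x \<in> input_box"
    and less: "\<And>i. i \<noteq> t \<Longrightarrow> (W $ i - W $ t) \<bullet> x < b $ t - b $ i"
    using assms by (auto simp: argmaxable_iff argmax_region_eq)
  \<comment> \<open>The summand 1 covers \<open>W $ i = W $ t\<close>.\<close>
  define q where
    "q i = (b $ t - b $ i - (W $ i - W $ t) \<bullet> x) / (norm (W $ i - W $ t) + 1)" for i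
  \<comment> \<open>The inserted 1 keeps the set nonempty even if \<open>t\<close> is the only
    class.\<close>
  define r where "r = Min (insert 1 (q ` (-{t})))"
  have "r > 0"
    unfolding r_def q_def using less
    by (auto simp: Min_gr_iff intro!: divide_pos_pos add_nonneg_pos)
  have "(W $ i - W $ t) \<bullet> x + r * norm (W $ i - W $ t) \<le> - (b $ i - b $ t)" if "i \<noteq> t" for i
  proof -
    have "r \<le> q i"
      unfolding r_def using that by (intro Min_le) auto
    moreover have "norm (W $ i - W $ t) + 1 > 0"
      by (simp add: add_nonneg_pos)
    ultimately have "r * (norm (W $ i - W $ t) + 1) \<le> b $ t - b $ i - (W $ i - W $ t) \<bullet> x"
      by (simp only: q_def pos_le_divide_eq)
    with \<open>r > 0\<close> show ?thesis
      by (simp only: distrib_left)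
  qed
  with box \<open>r > 0\<close> show ?thesis
    by (auto simp: lp_feasible_def lp_feasible_point_def input_box_def)
qed

theorem mainTheorem2:
  fixes W :: "real^'d^'n" and b :: "real^'n" and t :: 'n
  assumes "CARD('n) \<ge> 2"
  shows "((\<forall>i. i \<noteq> t \<longrightarrow> (W $ i, b $ i) \<noteq> (W $ t, b $ t)) \<longrightarrow>
           lp_feasible W b t \<longrightarrow>
             argmaxable W b t \<and>
             (\<forall>x r. lp_feasible_point W b t x r \<longrightarrow>
                emeasure lborel (argmax_region W b t) \<ge> emeasure lborel (ball (0 :: real^'d) r)))
         \<and> (\<not> lp_feasible W b t \<longrightarrow> unargmaxable W b t)"
  using lp_feasible_imp_argmaxable emeasure_argmax_region_ge argmaxable_imp_lp_feasible
  unfolding unargmaxable_def by blast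

end
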